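(* Let $\mathbb{F}$ be a field with characteristic $p\neq 2$ (with the convention $p=\infty$ if the identity has infinite additive order), and let $A$, $B$ and $S$ be finite nonempty subsets of $\mathbb{F}$. Then $$|\{a+b : a\in A,\ b\in B,\ \text{and}\ a-b\notin S\}|\ge\min\{p,\ |A|+|B|-|S|-q-1\},$$ where $q$ is the largest element of $\mathcal{P}(p)$ not exceeding $|S|$.
   Context: The characteristic of a field $\mathbb{F}$ is defined here as the additive order of its multiplicative identity; it is either a prime or $\infty$ (so $p=\infty$ corresponds to what is usually called characteristic $0$). Set $\mathcal{P}(p)=\{1,p,p^2,\ldots\}$ if $p<\infty$, and $\mathcal{P}(p)=\{1\}$ if $p=\infty$. *)

theory Defs
  imports Complex_Main "HOL-Library.Extended_Real"
begin

text \<open>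
  The least positive \<open>n\<close> with \<open>n x = 0\<close>; the infimum of the empty set in \<^typ>\<open>enat\<close> is
  \<open>\<infinity>\<close>, so an element of infinite order gets \<open>\<infinity>\<close> (where \<open>CHAR\<close> would give 0).
\<close>
definition additive_order :: "'a::ring_1 \<Rightarrow> enat" where
  "additive_order x = (INF n\<in>{n::nat. 0 < n \<and> of_nat n * x = 0}. enat n)"

definition field_char :: "'a::field itself \<Rightarrow> enat" where
  "field_char _ = additive_order (1::'a)"

definition char_powers :: "enat \<Rightarrow> nat set" where
  "char_powers p = (case p of enat m \<Rightarrow> range (\<lambda>k. m ^ k) | \<infinity> \<Rightarrow> {1})"

lemma field_char_eq_CHAR:
  "field_char TYPE('a::field) = (if CHAR('a) = 0 then \<infinity> else enat CHAR('a))"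
proof (cases "CHAR('a) = 0")
  case True
  then have "{n::nat. 0 < n \<and> of_nat n * (1::'a) = 0} = {}"
    by (auto simp: of_nat_eq_0_iff_char_dvd)
  then have "additive_order (1::'a) = \<infinity>"
    unfolding additive_order_def by (simp only: image_empty Inf_empty top_enat_def)
  with True show ?thesis
    by (simp add: field_char_def)
next
  case False
  have "(INF n\<in>{n::nat. 0 < n \<and> of_nat n * (1::'a) = 0}. enat n) = enat CHAR('a)"
  proof (rule antisym)
    show "(INF n\<in>{n::nat. 0 < n \<and> of_nat n * (1::'a) = 0}. enat n) \<le> enat CHAR('a)"
      using False by (intro INF_lower) auto
    show "enat CHAR('a) \<le> (INF n\<in>{n::nat. 0 < n \<and> of_nat n * (1::'a) = 0}. enat n)"
      by (intro INF_greatest) (auto simp: of_nat_eq_0_iff_char_dvd dest: dvd_imp_le)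
  qed
  then have "additive_order (1::'a) = enat CHAR('a)"
    unfolding additive_order_def .
  with False show ?thesis
    by (simp add: field_char_def)
qed

end

theory Submission
  imports Defs "HOL-Computational_Algebra.Polynomial"
begin

text \<open>
  The proof is an instance of the polynomial method. Write \<open>d\<close> for the size of \<open>S\<close>, and suppose
  that the restricted sumset \<open>C\<close> has at most \<open>N\<close> elements. The product of the linear forms
  \<open>x - y - s\<close> for \<open>s \<in> S\<close> and \<open>x + y - c\<close> for \<open>c \<in> C\<close>, padded with factors \<open>x + y\<close> to total degree
  \<open>d + N\<close>, vanishes on \<open>A \<times> B\<close>. By the Combinatorial Nullstellensatz
  (\<open>prod_linear_forms_nonzero_on_grid\<close>), its coefficient at \<open>x\<^sup>m y\<^sup>n\<close> is then 0 whenever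
  \<open>m + n = d + N\<close>, \<open>m < |A|\<close> and \<open>n < |B|\<close>. These coefficients depend only on the leading form; with
  \<open>y = 1\<close> they are the coefficients of \<open>f = (X - 1)\<^sup>d (X + 1)\<^sup>N\<close>. The admissible exponents \<open>m\<close> form a
  window of \<open>|A| + |B| - d - N - 1\<close> consecutive integers, so the theorem reduces to the claim
  that, for \<open>N < p\<close>, no \<open>q + 1\<close> consecutive coefficients of \<open>f\<close> between its lowest and
  its leading one are all 0. This is where \<open>q\<close> comes from: \<open>(X - 1)\<^sup>q = X\<^sup>q - 1\<close> has long gaps.

  For the claim, let \<open>u\<close> be the part of \<open>f\<close> below a gap. Since \<open>f' / f = d / (X - 1) + N / (X + 1)\<close>,
  \<open>f\<close> solves a first-order linear differential equation whose operator moves exponents by at most 1.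
  A gap of length at least 2 therefore makes \<open>u\<close> a solution as well
  (\<open>twisted_deriv_poly_cutoff\<close>). In characteristic 0 a nonzero polynomial solution has degree
  \<open>d + N\<close>, which \<open>u\<close> cannot have. In characteristic \<open>p\<close> the equation sees \<open>d\<close> only modulo \<open>p\<close>: the solutions
  are the products of \<open>G = (X - 1)\<^bsup>d mod p\<^esup> (X + 1)\<^sup>N\<close> with polynomials in \<open>X\<^sup>p\<close>
  (\<open>twisted_deriv_kernel_char_p\<close>). So \<open>f = G h(X\<^sup>p)\<close> with \<open>h = (X - 1)\<^bsup>d div p\<^esup>\<close>, and
  \<open>u = G v(X\<^sup>p)\<close>. Comparing \<open>v\<close> and \<open>h\<close> turns the gap of \<open>f\<close> into a run of vanishing coefficients of
  \<open>h\<close>. That run contains either the leading coefficient of \<open>h\<close> or a coefficient at a multiple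
  of \<open>q / p\<close> below its degree, and none of those is 0 (\<open>coeff_power_pred_multiple_nonzero\<close>).
\<close>

section \<open>A two-variable Nullstellensatz for products of linear forms\<close>

text \<open>
  The weights are those of the divided difference on \<open>A\<close>, which extracts the coefficient at
  \<open>X\<^sup>n\<close> from every polynomial of degree at most \<open>n\<close>. The induction adds a point \<open>b\<close> by applying the
  old functional to \<open>(g - g(b)) / (X - b)\<close>, a polynomial with one degree less.
\<close>
lemma exists_leading_coeff_weights:
  fixes A :: "'a::field set"
  assumes "card A = Suc n"
  shows "\<exists>w. \<forall>i\<le>n. (\<Sum>a\<in>A. w a * a ^ i) = (if i = n then 1 else 0)"
  using assms
proof (induction n arbitrary: A)
  case 0
  then obtain a where "A = {a}"
    by (auto simp: card_1_singleton_iff)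
  then show ?case
    by (intro exI[of _ "\<lambda>_. 1"]) auto
next
  case (Suc n)
  then have fin: "finite A" and ne: "A \<noteq> {}"
    by (auto intro: card_ge_0_finite)
  then obtain b where b: "b \<in> A"
    by blast
  let ?A = "A - {b}"
  have "card ?A = Suc n"
    using Suc.prems fin b by simp
  from Suc.IH[OF this] obtain w
    where w: "\<And>i. i \<le> n \<Longrightarrow> (\<Sum>a\<in>?A. w a * a ^ i) = (if i = n then 1 else 0)"
    by blast
  define w' where "w' a = (if a = b then - (\<Sum>a\<in>?A. w a / (a - b)) else w a / (a - b))" for a
  have "(\<Sum>a\<in>A. w' a * a ^ i) = (if i = Suc n then 1 else 0)" if "i \<le> Suc n" for i
  proof -
    have "(\<Sum>a\<in>A. w' a * a ^ i) = w' b * b ^ i + (\<Sum>a\<in>?A. w' a * a ^ i)"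
      using fin b by (rule sum.remove)
    also have "\<dots> = (\<Sum>a\<in>?A. w a / (a - b) * (a ^ i - b ^ i))"
      by (simp add: w'_def algebra_simps sum_subtractf sum_distrib_left)
    also have "\<dots> = (\<Sum>a\<in>?A. w a * (\<Sum>t<i. b ^ (i - Suc t) * a ^ t))"
      by (intro sum.cong refl) (simp add: power_diff_sumr2)
    also have "\<dots> = (\<Sum>t<i. b ^ (i - Suc t) * (\<Sum>a\<in>?A. w a * a ^ t))"
      unfolding sum_distrib_left by (subst sum.swap) (simp add: mult_ac)
    also have "\<dots> = (\<Sum>t<i. b ^ (i - Suc t) * (if t = n then 1 else 0))"
      using that by (intro sum.cong refl arg_cong2[where f = "(*)"] w) auto
    also have "\<dots> = (\<Sum>t<i. if n = t then b ^ (i - Suc t) else 0)"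
      by (intro sum.cong) auto
    also have "\<dots> = (if i = Suc n then 1 else 0)"
      using that by (auto simp: sum.delta)
    finally show ?thesis .
  qed
  then show ?case
    by blast
qed

text \<open>
  The product of the two divided differences extracts one coefficient of top total degree
  and annihilates everything of smaller total degree. The constant terms \<open>s\<close> therefore have
  no influence, and what remains is a coefficient of the product of the forms \<open>x + e y\<close>, read with
  \<open>y = 1\<close>. The monomial \<open>x\<^sup>i y\<^sup>j\<close> is there for the induction: splitting off one form produces
  the three cases \<open>(i + 1, j)\<close>, \<open>(i, j + 1)\<close> and \<open>(i, j)\<close>.
\<close>
lemma weighted_sum_prod_linear_forms:
  fixes u v :: "'a::field \<Rightarrow> 'a" and L :: "('a \<times> 'a) list"
  assumes u: "\<And>i. i \<le> m \<Longrightarrow> (\<Sum>a\<in>A. u a * a ^ i) = (if i = m then 1 else 0)"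
    and v: "\<And>j. j \<le> n \<Longrightarrow> (\<Sum>b\<in>B. v b * b ^ j) = (if j = n then 1 else 0)"
    and "i + j + length L \<le> m + n"
  shows "(\<Sum>a\<in>A. \<Sum>b\<in>B. u a * v b * (a ^ i * b ^ j * (\<Prod>(e, s)\<leftarrow>L. a + e * b - s))) =
    (if i + j + length L = m + n
     then coeff (monom 1 i * (\<Prod>(e, s)\<leftarrow>L. [:e, 1:])) m else 0)"
  using assms(3)
proof (induction L arbitrary: i j)
  case Nil
  have "(\<Sum>a\<in>A. \<Sum>b\<in>B. u a * v b * (a ^ i * b ^ j)) =
      (\<Sum>a\<in>A. u a * a ^ i) * (\<Sum>b\<in>B. v b * b ^ j)"
    by (simp add: sum_product mult_ac)
  also have "\<dots> = (if i + j = m + n then if i = m then 1 else 0 else 0)"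
  proof (cases "i \<le> m \<and> j \<le> n")
    case True
    then show ?thesis
      by (auto simp: u v)
  next
    case False
    with Nil have "i < m \<or> j < n \<and> i \<noteq> m"
      by auto
    then show ?thesis
      by (auto simp: u v)
  qed
  finally show ?case
    by simp
next
  case (Cons es L)
  obtain e s where es: "es = (e, s)"
    by (cases es)
  define T where "T i j = (\<Sum>a\<in>A. \<Sum>b\<in>B. u a * v b *
    (a ^ i * b ^ j * (\<Prod>(e, s)\<leftarrow>L. a + e * b - s)))" for i j
  define P where "P = (\<Prod>(e, s)\<leftarrow>L. [:e, 1:])"
  have IH: "T i j = (if i + j + length L = m + n then coeff (monom 1 i * P) m else 0)"
    if "i + j + length L \<le> m + n" for i j
    unfolding T_def P_def using that by (rule Cons.IH)
  have mon: "monom 1 (Suc i) = [:0, 1:] * monom (1::'a) i"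
    by (simp add: monom_Suc)
  have "(\<Sum>a\<in>A. \<Sum>b\<in>B. u a * v b * (a ^ i * b ^ j * (\<Prod>(e, s)\<leftarrow>es # L. a + e * b - s)))
      = T (Suc i) j + e * T i (Suc j) - s * T i j"
    unfolding T_def es
    by (simp add: sum_distrib_left algebra_simps sum.distrib sum_subtractf)
  also have "\<dots> = (if i + j + length (es # L) = m + n
      then coeff (monom 1 (Suc i) * P + smult e (monom 1 i * P)) m else 0)"
    using Cons.prems by (simp add: IH)
  also have "monom 1 (Suc i) * P + smult e (monom 1 i * P) = monom 1 i * ([:e, 1:] * P)"
    unfolding mon by (simp add: algebra_simps)
  finally show ?case
    by (simp add: es P_def)
qed

text \<open>
  The Combinatorial Nullstellensatz in two variables, for products of linear forms: if the
  product vanished on the whole grid, so would every weighted sum of its values.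
\<close>
lemma prod_linear_forms_nonzero_on_grid:
  fixes A B :: "'a::field set" and L :: "('a \<times> 'a) list"
  assumes "coeff (\<Prod>(e, s)\<leftarrow>L. [:e, 1:]) m \<noteq> 0" and "length L = m + n"
    and "m < card A" and "n < card B"
  obtains a b where "a \<in> A" "b \<in> B" "\<And>e s. (e, s) \<in> set L \<Longrightarrow> a + e * b \<noteq> s"
proof -
  obtain A' where A': "A' \<subseteq> A" "card A' = Suc m"
    using assms(3) by (metis Suc_leI obtain_subset_with_card_n)
  obtain B' where B': "B' \<subseteq> B" "card B' = Suc n"
    using assms(4) by (metis Suc_leI obtain_subset_with_card_n)
  obtain u where u: "\<And>i. i \<le> m \<Longrightarrow> (\<Sum>a\<in>A'. u a * a ^ i) = (if i = m then 1 else 0)"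
    using exists_leading_coeff_weights[OF A'(2)] by blast
  obtain v where v: "\<And>j. j \<le> n \<Longrightarrow> (\<Sum>b\<in>B'. v b * b ^ j) = (if j = n then 1 else 0)"
    using exists_leading_coeff_weights[OF B'(2)] by blast
  have "(\<Sum>a\<in>A'. \<Sum>b\<in>B'. u a * v b * (\<Prod>(e, s)\<leftarrow>L. a + e * b - s)) \<noteq> 0"
    using weighted_sum_prod_linear_forms[where u = u and v = v and i = 0 and j = 0 and L = L,
        OF u v] assms(1,2) by simp
  then obtain a where a: "a \<in> A'" "(\<Sum>b\<in>B'. u a * v b * (\<Prod>(e, s)\<leftarrow>L. a + e * b - s)) \<noteq> 0"
    by (meson sum.neutral)
  then obtain b where b: "b \<in> B'" "u a * v b * (\<Prod>(e, s)\<leftarrow>L. a + e * b - s) \<noteq> 0"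
    by (meson sum.neutral)
  have "a + e * b \<noteq> s" if "(e, s) \<in> set L" for e s
    using b(2) that by (force simp: prod_list_zero_iff)
  then show ?thesis
    using a b A' B' that by blast
qed

text \<open>
  The forms are \<open>x - y - s\<close> for \<open>s \<in> S\<close> and \<open>x + y - c\<close> for \<open>c\<close> in the restricted sumset; a point of
  \<open>A \<times> B\<close> at which all of them are nonzero would be a pair that contributes a sum outside the
  sumset.
\<close>
lemma restricted_sumset_card_gt:
  fixes A B S :: "'a::field set"
  assumes fin: "finite A" "finite B" "finite S"
    and coeff: "coeff ([:-1, 1:] ^ card S * [:1, 1:] ^ N) m \<noteq> (0::'a)"
    and mn: "m + n = card S + N" and "m < card A" and "n < card B"
  shows "N < card {a + b | a b. a \<in> A \<and> b \<in> B \<and> a - b \<notin> S}"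
proof (rule ccontr)
  define C where "C = {a + b | a b. a \<in> A \<and> b \<in> B \<and> a - b \<notin> S}"
  assume "\<not> N < card {a + b | a b. a \<in> A \<and> b \<in> B \<and> a - b \<notin> S}"
  then have le: "card C \<le> N"
    by (simp add: C_def)
  have "C \<subseteq> (\<lambda>(a, b). a + b) ` (A \<times> B)"
    unfolding C_def by auto
  then have "finite C"
    by (rule finite_subset) (use fin in auto)
  then obtain Cs where Cs: "set Cs = C" "length Cs = card C"
    by (metis finite_distinct_list distinct_card)
  obtain Ss where Ss: "set Ss = S" "length Ss = card S"
    using fin(3) by (metis finite_distinct_list distinct_card)
  \<comment> \<open>The forms \<open>x + y - 0\<close> only fill the total degree up to \<open>d + N\<close>, where \<open>d\<close> is the size of \<open>S\<close>.\<close>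
  define L :: "('a \<times> 'a) list"
    where "L = map (Pair (-1)) Ss @ map (Pair 1) Cs @ replicate (N - card C) (1, 0)"
  have "length L = m + n"
    using le by (simp add: L_def Cs Ss mn)
  moreover have "(\<Prod>(e, s)\<leftarrow>L. [:e, 1:]) = [:-1, 1:] ^ card S * [:1, 1:] ^ N"
    using le by (simp add: L_def o_def map_replicate_const Cs Ss mult.assoc flip: power_add)
  ultimately obtain a b
    where ab: "a \<in> A" "b \<in> B" "\<And>e s. (e, s) \<in> set L \<Longrightarrow> a + e * b \<noteq> s"
    using prod_linear_forms_nonzero_on_grid[of L m n A B] coeff assms(6,7) by metis
  have "a - b \<notin> S"
    using ab(3)[of "-1"] by (auto simp: L_def Ss)
  moreover have "a + b \<notin> C"
    using ab(3)[of 1] by (auto simp: L_def Cs)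
  ultimately show False
    using ab by (auto simp: C_def)
qed

section \<open>Powers of \<open>X - 1\<close> in prime characteristic\<close>

lemma coeff_pcompose_monom:
  fixes t :: "'a::comm_ring_1 poly"
  assumes "n > 0"
  shows "coeff (pcompose t (monom 1 n)) i = (if n dvd i then coeff t (i div n) else 0)"
proof (induction t arbitrary: i)
  case 0
  then show ?case by simp
next
  case (pCons a t)
  show ?case
  proof (cases "n \<le> i")
    case True
    then have "i = (i - n) + n" "i \<noteq> 0" using assms by auto
    then obtain k where k: "i = k + n" "i \<noteq> 0" by metis
    then show ?thesis
      using assms by (auto simp: pcompose_pCons coeff_monom_mult pCons.IH coeff_pCons split: nat.splits)
  next
    case False
    then show ?thesis
      by (auto simp: pcompose_pCons coeff_monom_mult coeff_pCons dest: dvd_imp_le split: nat.splits)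
  qed
qed

lemma pcompose_power: "pcompose (s ^ n) t = pcompose s t ^ n" for s t :: "'a::comm_semiring_1 poly"
  by (induction n) (simp_all add: pcompose_mult pcompose_1)

lemma frobenius_linear:
  fixes c :: "'a::field"
  assumes "prime CHAR('a)" "Q = CHAR('a) ^ e"
  shows "[:c, 1:] ^ Q = [:c ^ Q:] + monom 1 Q"
proof -
  have "[:c, 1:] = [:c:] + monom 1 1" by (simp add: monom_Suc monom_0)
  then show ?thesis
    using freshmans_dream'[of Q e "[:c:]" "monom 1 1"] assms
    by (simp add: monom_power poly_const_pow)
qed

text \<open>
  A case of Lucas' theorem. Write \<open>d = m Q + r\<close> with \<open>m < p\<close> and \<open>r < Q\<close>, where \<open>p\<close> is the
  characteristic; then \<open>(X - 1)\<^sup>d = (X\<^sup>Q - 1)\<^sup>m (X - 1)\<^sup>r\<close>. Only the constant term of the second factor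
  meets the exponents divisible by \<open>Q\<close>, so the coefficient is a binomial coefficient \<open>m choose j\<close> up
  to sign, and \<open>p\<close> does not divide it.
\<close>
lemma coeff_power_pred_multiple_nonzero:
  assumes "prime CHAR('a::field)" and "Q = CHAR('a) ^ e"
    and d: "d < Q * CHAR('a)" and "j * Q \<le> d"
    and odd: "odd CHAR('a)"
  shows "coeff ([:-1, 1:] ^ d :: 'a poly) (j * Q) \<noteq> 0"
proof -
  define p where "p = CHAR('a)"
  have Q: "Q > 0" using assms by (simp add: prime_gt_0_nat)
  define m r where "m = d div Q" and "r = d mod Q"
  have d_eq: "d = Q * m + r" and r: "r < Q" using Q by (auto simp: m_def r_def)
  have m: "m < p" using d unfolding m_def p_def by (simp add: less_mult_imp_div_less mult.commute)
  have j: "j \<le> m" unfolding m_def using assms(4) Q by (simp add: less_eq_div_iff_mult_less_eq)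
  have "(-1::'a) ^ Q = -1" using odd assms(2) by simp
  then have "[:-1, 1::'a:] ^ Q = pcompose [:-1, 1:] (monom 1 Q)"
    by (subst frobenius_linear[OF assms(1,2)]) (simp add: pcompose_pCons)
  then have eq: "[:-1, 1::'a:] ^ d = pcompose ([:-1, 1:] ^ m) (monom 1 Q) * [:-1, 1:] ^ r"
    unfolding d_eq by (simp add: power_add power_mult pcompose_power)
  have "coeff ([:-1, 1::'a:] ^ d) (j * Q) =
      (\<Sum>i\<le>j * Q. coeff (pcompose ([:-1, 1:] ^ m) (monom 1 Q)) i * coeff ([:-1, 1::'a:] ^ r) (j * Q - i))"
    unfolding eq by (rule coeff_mult)
  also have "\<dots> = (\<Sum>i\<in>{j * Q}. coeff (pcompose ([:-1, 1:] ^ m) (monom 1 Q)) i * coeff ([:-1, 1::'a:] ^ r) (j * Q - i))"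
  proof (intro sum.mono_neutral_right ballI)
    fix i assume i: "i \<in> {..j * Q} - {j * Q}"
    show "coeff (pcompose ([:-1, 1:] ^ m) (monom 1 Q)) i * coeff ([:-1, 1::'a:] ^ r) (j * Q - i) = 0"
    proof (cases "Q dvd i")
      case True
      then have "Q dvd j * Q - i" "j * Q - i > 0" using i by auto
      then have "Q \<le> j * Q - i" by (simp add: dvd_imp_le)
      with r have "coeff ([:-1, 1::'a:] ^ r) (j * Q - i) = 0"
        by (intro coeff_eq_0) (simp add: degree_linear_power)
      then show ?thesis by simp
    qed (simp add: coeff_pcompose_monom Q)
  qed auto
  also have "\<dots> = of_nat (m choose j) * (-1) ^ (m - j) * (-1) ^ r"
    using Q j by (simp add: coeff_pcompose_monom coeff_0_power coeff_linear_poly_power)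
  finally have coeff: "coeff ([:-1, 1::'a:] ^ d) (j * Q) = of_nat (m choose j) * (-1) ^ (m - j) * (-1) ^ r" .
  have "\<not> p dvd fact m"
    using m assms(1) by (simp add: p_def prime_dvd_fact_iff)
  then have "\<not> p dvd (m choose j)"
    using binomial_fact_lemma[OF j] by (metis dvd_mult2 dvd_mult)
  then have "of_nat (m choose j) \<noteq> (0::'a)"
    by (simp add: of_nat_eq_0_iff_char_dvd p_def)
  then show ?thesis
    unfolding coeff by simp
qed


section \<open>A differential equation for \<open>(X - 1)\<^sup>d (X + 1)\<^sup>N\<close>\<close>

text \<open>
  The derivation \<open>d/dX\<close> conjugated by \<open>(X - 1)\<^sup>a (X + 1)\<^sup>b\<close> and cleared of denominators: it is
  \<open>(X\<^sup>2 - 1) (u' - (a / (X - 1) + b / (X + 1)) u)\<close>.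
\<close>
definition twisted_deriv :: "'a::field \<Rightarrow> 'a \<Rightarrow> 'a poly \<Rightarrow> 'a poly" where
  "twisted_deriv a b u = [:-1, 0, 1:] * pderiv u + [:b - a, - (a + b):] * u"

lemma coeff_twisted_deriv:
  fixes u :: "'a::field poly"
  shows "coeff (twisted_deriv a b u) j =
    (if j = 0 then 0 else (of_nat (j - 1) - (a + b)) * coeff u (j - 1))
      + (b - a) * coeff u j - of_nat (Suc j) * coeff u (Suc j)"
proof -
  consider "j = 0" | "j = 1" | k where "j = Suc (Suc k)"
    by (metis One_nat_def not0_implies_Suc)
  then show ?thesis
    by cases (simp_all add: twisted_deriv_def coeff_pderiv coeff_pCons algebra_simps)
qed

text \<open>
  The Leibniz rule: \<open>a / (X - 1) + b / (X + 1)\<close> is a logarithmic derivative, and these add up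
  under multiplication.
\<close>
lemma twisted_deriv_mult:
  fixes u v :: "'a::field poly"
  shows "twisted_deriv (a + a') (b + b') (u * v) = twisted_deriv a b u * v + u * twisted_deriv a' b' v"
proof -
  have "[:b + b' - (a + a'), - (a + a' + (b + b')):] =
      [:b - a, - (a + b):] + [:b' - a', - (a' + b'):]"
    by simp
  then show ?thesis
    unfolding twisted_deriv_def pderiv_mult by (simp only: ring_distribs mult_ac add_ac)
qed

lemma twisted_deriv_linear_powers:
  "twisted_deriv (of_nat d) (of_nat N) ([:-1, 1:] ^ d * [:1, 1:] ^ N :: 'a::field poly) = 0"
proof -
  have 1: "twisted_deriv (of_nat d) 0 ([:-1, 1:] ^ d :: 'a poly) = 0"
  proof (induction d)
    case (Suc d)
    have "twisted_deriv 1 0 ([:-1, 1:] :: 'a poly) = 0"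
      by (simp add: twisted_deriv_def pderiv_pCons)
    with Suc show ?case
      using twisted_deriv_mult[of 1 "of_nat d" 0 0 "[:-1, 1 :: 'a:]" "[:-1, 1:] ^ d"] by simp
  qed (simp add: twisted_deriv_def)
  have 2: "twisted_deriv 0 (of_nat N) ([:1, 1:] ^ N :: 'a poly) = 0"
  proof (induction N)
    case (Suc N)
    have "twisted_deriv 0 1 ([:1, 1:] :: 'a poly) = 0"
      by (simp add: twisted_deriv_def pderiv_pCons)
    with Suc show ?case
      using twisted_deriv_mult[of 0 0 1 "of_nat N" "[:1, 1 :: 'a:]" "[:1, 1:] ^ N"] by simp
  qed (simp add: twisted_deriv_def)
  show ?thesis
    using twisted_deriv_mult[of "of_nat d" 0 0 "of_nat N" "[:-1, 1 :: 'a:] ^ d" "[:1, 1:] ^ N"]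
    by (simp add: 1 2)
qed

text \<open>
  By \<open>coeff_twisted_deriv\<close> the coefficient of the image at \<open>j\<close> involves only those of \<open>f\<close> at
  \<open>j - 1\<close>, \<open>j\<close> and \<open>j + 1\<close>. Two consecutive zeros thus separate the images of the lower and the upper
  part of \<open>f\<close>, which cannot cancel each other.
\<close>
lemma twisted_deriv_poly_cutoff:
  fixes f :: "'a::field poly"
  assumes f: "twisted_deriv a b f = 0" and zeros: "coeff f i = 0" "coeff f (Suc i) = 0"
  shows "twisted_deriv a b (poly_cutoff i f) = 0"
proof (rule poly_eqI)
  fix j
  have "coeff (poly_cutoff i f) k = coeff f k" if "k \<le> Suc i" for k
    using zeros that by (auto simp: coeff_poly_cutoff le_Suc_eq)
  then have "coeff (twisted_deriv a b (poly_cutoff i f)) j = coeff (twisted_deriv a b f) j" if "j \<le> i"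
    using that by (simp add: coeff_twisted_deriv)
  moreover have "coeff (twisted_deriv a b (poly_cutoff i f)) j = 0" if "j > i"
    using that by (auto simp: coeff_twisted_deriv coeff_poly_cutoff)
  ultimately show "coeff (twisted_deriv a b (poly_cutoff i f)) j = coeff 0 j"
    using f by (cases "j \<le> i") simp_all
qed

lemma pderiv_eq_0_imp_pcompose:
  fixes w :: "'a::field poly"
  assumes "prime CHAR('a)" and "pderiv w = 0"
  obtains t where "w = pcompose t (monom 1 CHAR('a))"
proof
  define p where "p = CHAR('a)"
  have p: "p > 0"
    using assms(1) by (simp add: p_def prime_gt_0_nat)
  define t where "t = (\<Sum>i\<le>degree w. monom (coeff w (p * i)) i)"
  have t: "coeff t k = coeff w (p * k)" for k
  proof (cases "k \<le> degree w")
    case False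
    have "k \<le> p * k"
      using p by simp
    with False have "coeff w (p * k) = 0"
      by (intro coeff_eq_0) linarith
    with False show ?thesis
      by (simp add: t_def coeff_sum)
  qed (simp add: t_def coeff_sum)
  have "coeff w i = 0" if "\<not> p dvd i" for i
  proof (cases i)
    case (Suc k)
    have "of_nat i * coeff w i = coeff (pderiv w) k"
      by (simp add: coeff_pderiv Suc)
    then show ?thesis
      using that assms(2) by (simp add: p_def of_nat_eq_0_iff_char_dvd)
  qed (use that in simp)
  then show "w = pcompose t (monom 1 CHAR('a))"
    unfolding p_def[symmetric] using p by (intro poly_eqI) (simp add: coeff_pcompose_monom t)
qed

text \<open>
  Multiplication by \<open>E = (X - 1)\<^bsup>p - r\<^esup> (X + 1)\<^bsup>p - N\<^esup>\<close>, where \<open>r = d mod p\<close>, makes both exponents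
  of the equation multiples of \<open>p\<close>, that is 0 in the field. So \<open>E u\<close> has derivative 0 and is a
  polynomial \<open>t(X\<^sup>p)\<close>. As \<open>r\<close> and \<open>N\<close> are less than \<open>p\<close>, \<open>E\<close> vanishes at 1 and at -1, which are
  distinct in odd characteristic; so \<open>(X - 1) (X + 1)\<close> divides \<open>t\<close>. Substituting \<open>X\<^sup>p\<close> gives
  the factor \<open>(X - 1)\<^sup>p (X + 1)\<^sup>p\<close> of \<open>E u\<close>, from which \<open>E\<close> cancels.
\<close>
lemma twisted_deriv_kernel_char_p:
  fixes u :: "'a::field poly"
  assumes p: "p = CHAR('a)" "prime p" "odd p" and "N < p"
    and u: "twisted_deriv (of_nat d) (of_nat N) u = 0"
  obtains v where "u = [:-1, 1:] ^ (d mod p) * [:1, 1:] ^ N * pcompose v (monom 1 p)"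
proof -
  define r where "r = d mod p"
  have r: "r < p"
    using p by (simp add: r_def prime_gt_0_nat)
  define E :: "'a poly" where "E = [:-1, 1:] ^ (p - r) * [:1, 1:] ^ (p - N)"
  have E: "poly E 1 = 0" "poly E (-1) = 0" "E \<noteq> 0"
    using r assms(4) by (simp_all add: E_def)
  have "of_nat (p - r) + of_nat d = (0::'a)"
  proof -
    obtain k where "d = p * k + r"
      using mult_div_mod_eq[of p d] unfolding r_def by metis
    then have "p - r + d = p * (k + 1)"
      using r by simp
    then show ?thesis
      by (metis dvd_triv_left of_nat_add of_nat_eq_0_iff_char_dvd p(1))
  qed
  moreover have "of_nat (p - N) + of_nat N = (0::'a)"
    using assms(4) p(1) by (simp flip: of_nat_add)
  ultimately have "twisted_deriv 0 0 (E * u) = 0"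
    using twisted_deriv_mult[of "of_nat (p - r)" "of_nat d" "of_nat (p - N)" "of_nat N" E u] u
    by (simp add: E_def twisted_deriv_linear_powers)
  then have "[:-1, 0, 1:] * pderiv (E * u) = 0"
    by (simp add: twisted_deriv_def del: mult_pCons_left)
  then have "pderiv (E * u) = 0"
    by (simp del: mult_pCons_left)
  then obtain t where t: "E * u = pcompose t (monom 1 p)"
    using pderiv_eq_0_imp_pcompose p by metis
  have "poly t 1 = 0" "poly t (-1) = 0"
    using arg_cong[OF t, of "\<lambda>w. poly w 1"] arg_cong[OF t, of "\<lambda>w. poly w (-1)"] E p(3)
    by (simp_all add: poly_pcompose poly_monom)
  moreover obtain t' where t': "t = [:-1, 1:] * t'"
    using \<open>poly t 1 = 0\<close> by (auto simp: poly_eq_0_iff_dvd)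
  moreover have "(-2::'a) \<noteq> 0"
  proof -
    have "\<not> p dvd 2"
      using p by (metis dvd_refl prime_nat_iff even_numeral two_is_prime_nat primes_dvd_imp_eq)
    then show ?thesis
      using of_nat_eq_0_iff_char_dvd[of 2, where 'a = 'a] p(1) by simp
  qed
  ultimately have "poly t' (-1) = 0"
    by simp
  then obtain v where v: "t' = [:1, 1:] * v"
    by (auto simp: poly_eq_0_iff_dvd)
  have frob: "pcompose [:c, 1:] (monom 1 p) = [:c, 1:] ^ p" if "c ^ p = c" for c :: 'a
    using frobenius_linear[of p 1 c] p that by (simp add: pcompose_pCons)
  have "E * u = [:-1, 1:] ^ p * [:1, 1:] ^ p * pcompose v (monom 1 p)"
    unfolding t t' v pcompose_mult using p(3) by (simp add: frob mult.assoc)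
  also have "[:-1, 1:] ^ p = [:-1, 1::'a:] ^ (p - r) * [:-1, 1:] ^ r"
    using r by (simp flip: power_add)
  also have "[:1, 1:] ^ p = [:1, 1::'a:] ^ (p - N) * [:1, 1:] ^ N"
    using assms(4) by (simp flip: power_add)
  finally have "E * u = E * ([:-1, 1:] ^ r * [:1, 1:] ^ N * pcompose v (monom 1 p))"
    by (simp only: E_def mult_ac)
  then show thesis
    using E(3) that unfolding r_def by simp
qed

section \<open>Gaps between nonzero coefficients\<close>

text \<open>
  The leading coefficient of the differential equation determines the degree of a nonzero
  solution. The lower part of the polynomial has too small a degree for a solution.
\<close>
lemma consecutive_coeffs_char_0:
  assumes "CHAR('a::field) = 0" and i: "0 < i" "i < d + N"
  shows "\<exists>j\<in>{i, Suc i}. coeff ([:-1, 1:] ^ d * [:1, 1:] ^ N :: 'a poly) j \<noteq> 0"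
proof (rule ccontr)
  define f :: "'a poly" where "f = [:-1, 1:] ^ d * [:1, 1:] ^ N"
  define u where "u = poly_cutoff i f"
  assume "\<not> ?thesis"
  then have "coeff f i = 0" "coeff f (Suc i) = 0"
    by (simp_all add: f_def)
  then have Lu: "twisted_deriv (of_nat d) (of_nat N) u = 0"
    unfolding u_def by (intro twisted_deriv_poly_cutoff) (simp_all add: f_def twisted_deriv_linear_powers)
  have "coeff u 0 \<noteq> 0"
    using i by (simp add: u_def coeff_poly_cutoff f_def coeff_mult_0 coeff_0_power)
  then have u: "u \<noteq> 0"
    by auto
  have "coeff (twisted_deriv (of_nat d) (of_nat N) u) (Suc (degree u)) =
      (of_nat (degree u) - of_nat (d + N)) * lead_coeff u"
    by (simp add: coeff_twisted_deriv coeff_eq_0)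
  then have "(of_nat (degree u) :: 'a) = of_nat (d + N)"
    using u by (simp add: Lu)
  moreover have "degree u < i"
    using u i coeff_poly_cutoff[of i f "degree u"] unfolding u_def[symmetric]
    by (auto split: if_splits)
  ultimately have "of_nat (d + N - degree u) = (0::'a)"
    using i by (subst of_nat_diff) simp_all
  then have "d + N - degree u = 0"
    using assms(1) unfolding of_nat_eq_0_iff_char_dvd by simp
  then show False
    using i \<open>degree u < i\<close> by simp
qed

text \<open>
  In the notation of the proof, \<open>u = G v(X\<^sup>p)\<close> has degree less than \<open>i\<close>, which bounds the
  degree of \<open>v\<close>, and \<open>f - u = G (h - v)(X\<^sup>p)\<close> is divisible by \<open>X\<^bsup>i + q + 1\<^esup>\<close>, which makes the low
  coefficients of \<open>h\<close> and \<open>v\<close> agree. So \<open>h = (X - 1)\<^bsup>d div p\<^esup>\<close> has coefficient 0 at every \<open>k\<close> with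
  \<open>i \<le> p k + deg G\<close> and \<open>p k \<le> i + q\<close>. The contradiction comes from \<open>k = d div p\<close> if this index is in
  that range, and otherwise from a multiple \<open>p k\<close> of \<open>q\<close> among the integers from \<open>i + 1\<close> to \<open>i + q\<close>.
\<close>
lemma consecutive_coeffs_char_p:
  assumes p: "p = CHAR('a::field)" "prime p" "odd p" and N: "N < p"
    and q: "q = p ^ e" "q \<le> d" "d < q * p" and i: "0 < i" "i + q \<le> d + N"
  shows "\<exists>j\<in>{i..i + q}. coeff ([:-1, 1:] ^ d * [:1, 1:] ^ N :: 'a poly) j \<noteq> 0"
proof (rule ccontr)
  define f :: "'a poly" where "f = [:-1, 1:] ^ d * [:1, 1:] ^ N"
  define u where "u = poly_cutoff i f"
  define G :: "'a poly" where "G = [:-1, 1:] ^ (d mod p) * [:1, 1:] ^ N"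
  define h :: "'a poly" where "h = [:-1, 1:] ^ (d div p)"
  assume "\<not> ?thesis"
  then have zeros: "coeff f j = 0" if "i \<le> j" "j \<le> i + q" for j
    using that by (simp add: f_def)
  have p0: "p > 0" and q0: "q > 0"
    using p q by (simp_all add: prime_gt_0_nat)
  have "twisted_deriv (of_nat d) (of_nat N) u = 0"
    unfolding u_def using q0
    by (intro twisted_deriv_poly_cutoff zeros) (simp_all add: f_def twisted_deriv_linear_powers)
  then obtain v where v: "u = G * pcompose v (monom 1 p)"
    unfolding G_def using twisted_deriv_kernel_char_p[OF p N] by metis
  have "pcompose h (monom 1 p) = ([:-1, 1:] ^ p) ^ (d div p)"
    unfolding h_def pcompose_power
    using frobenius_linear[of p 1 "-1 :: 'a"] p by (simp add: pcompose_pCons)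
  then have f_eq: "f = G * pcompose h (monom 1 p)"
    by (simp add: f_def G_def mult_ac flip: power_mult power_add)
  have degG: "degree G = d mod p + N"
    by (simp add: G_def degree_mult_eq degree_linear_power)
  have G0: "poly G 0 \<noteq> 0"
    by (simp add: G_def)
  have "coeff u 0 \<noteq> 0"
    using i by (simp add: u_def coeff_poly_cutoff f_def coeff_mult_0 coeff_0_power)
  then have u: "u \<noteq> 0"
    by auto
  have "degree u < i"
    using u i coeff_poly_cutoff[of i f "degree u"] unfolding u_def[symmetric]
    by (auto split: if_splits)
  then have deg_v: "degree G + p * degree v < i"
    using u p0 unfolding v by (auto simp: degree_mult_eq degree_pcompose degree_monom_eq mult.commute)
  have v_zero: "coeff v k = 0" if "i \<le> p * k + degree G" for k
  proof (rule ccontr)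
    assume "coeff v k \<noteq> 0"
    then have "p * k \<le> p * degree v"
      by (simp add: le_degree)
    with deg_v that show False
      by linarith
  qed
  have hv: "coeff h k = coeff v k" if "p * k \<le> i + q" for k
  proof (cases "h = v")
    case False
    define z where "z = pcompose (h - v) (monom 1 p)"
    have "z \<noteq> 0"
      unfolding z_def using False p0 by (subst pcompose_eq_0_iff) (simp_all add: degree_monom_eq)
    moreover have fu: "f - u = G * z"
      unfolding f_eq v z_def pcompose_diff by (simp add: algebra_simps)
    moreover have "G \<noteq> 0"
      using G0 by auto
    moreover have "monom 1 (Suc (i + q)) dvd f - u"
      unfolding monom_1_dvd_iff' by (auto simp: u_def coeff_poly_cutoff zeros)
    ultimately have "Suc (i + q) \<le> order 0 z"
      using G0 by (simp add: monom_1_dvd_iff order_mult order_0I del: One_nat_def)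
    then have "monom 1 (Suc (i + q)) dvd z"
      using \<open>z \<noteq> 0\<close> by (simp add: monom_1_dvd_iff)
    then have "coeff z (p * k) = 0"
      using that by (simp add: monom_1_dvd_iff')
    then show ?thesis
      using p0 by (simp add: z_def coeff_pcompose_monom)
  qed simp
  show False
  proof (cases "p * (d div p) \<le> i + q")
    case True
    have "i \<le> p * (d div p) + degree G"
      using i mult_div_mod_eq[of p d] unfolding degG by linarith
    then have "coeff h (d div p) = 0"
      using hv[OF True] v_zero by simp
    then show False
      by (simp add: h_def coeff_linear_power)
  next
    case False
    \<comment> \<open>For \<open>q = 1\<close> the previous case always applies, because then \<open>d div p = 0\<close>.\<close>
    have "e \<noteq> 0"
      using False q by (intro notI) (simp add: div_less)
    then obtain e' where e': "e = Suc e'"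
      by (metis not0_implies_Suc)
    define Q where "Q = p ^ e'"
    have qQ: "q = p * Q"
      by (simp add: q e' Q_def)
    define j where "j = (i + q) div q"
    have j: "j * q \<le> i + q" "i < j * q"
      using q0 div_mod_decomp[of "i + q" q] mod_less_divisor[OF q0, of "i + q"]
      unfolding j_def by linarith+
    have pk: "p * (j * Q) = j * q"
      by (simp add: qQ)
    then have "p * (j * Q) \<le> p * (d div p)"
      using j False by linarith
    then have "j * Q \<le> d div p"
      using p0 by simp
    moreover have "d div p < Q * p"
      using q(3) by (intro less_mult_imp_div_less) (simp add: qQ mult_ac)
    ultimately have "coeff h (j * Q) \<noteq> 0"
      unfolding h_def using p by (intro coeff_power_pred_multiple_nonzero[where e = e']) (simp_all add: Q_def)
    moreover have "coeff h (j * Q) = 0"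
      using hv[of "j * Q"] v_zero[of "j * Q"] j unfolding pk by simp
    ultimately show False
      by simp
  qed
qed

section \<open>The bound on the restricted sumset\<close>

text \<open>
  The exponents \<open>m\<close> with \<open>m < |A|\<close> and \<open>d + N - m < |B|\<close> form a window of at least \<open>q + 1\<close>
  integers. If the window leaves the range from 0 to \<open>d + N\<close>, it contains one of the end points, where
  the coefficient is a unit; otherwise the gap bound applies to it.
\<close>
lemma restricted_sumset_card_gt_of_gap_bound:
  fixes A B S :: "'a::field set"
  assumes fin: "finite A" "finite B" "finite S" and ne: "A \<noteq> {}" "B \<noteq> {}"
    and gap: "\<And>i. \<lbrakk>0 < i; i + q \<le> card S + N\<rbrakk> \<Longrightarrow>
      \<exists>j\<in>{i..i + q}. coeff ([:-1, 1:] ^ card S * [:1, 1:] ^ N) j \<noteq> (0::'a)"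
    and le: "card S + N + q + 2 \<le> card A + card B"
  shows "N < card {a + b | a b. a \<in> A \<and> b \<in> B \<and> a - b \<notin> S}"
proof -
  define d where "d = card S"
  define f :: "'a poly" where "f = [:-1, 1:] ^ d * [:1, 1:] ^ N"
  have pos: "card A > 0" "card B > 0"
    using fin ne by (simp_all add: card_gt_0_iff)
  have "\<exists>m. coeff f m \<noteq> 0 \<and> m \<le> d + N \<and> m < card A \<and> d + N - m < card B"
  proof -
    consider "d + N < card B" | "d + N < card A"
      | "card B \<le> d + N" "card A \<le> d + N"
      by linarith
    then show ?thesis
    proof cases
      case 1
      have "coeff f 0 \<noteq> 0"
        by (simp add: f_def coeff_mult_0 coeff_0_power)
      with 1 pos show ?thesis
        by (intro exI[of _ 0]) simp
    next
      case 2
      have deg: "degree f = d + N"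
        by (simp add: f_def degree_mult_eq degree_linear_power)
      have "f \<noteq> 0"
        by (simp add: f_def)
      then have "coeff f (d + N) \<noteq> 0"
        by (metis deg leading_coeff_0_iff)
      with 2 pos show ?thesis
        by (intro exI[of _ "d + N"]) simp
    next
      case 3
      define i where "i = d + N + 1 - card B"
      have i: "0 < i" "i + q < card A" "i + card B = d + N + 1"
        using 3 le by (auto simp: i_def d_def)
      then obtain j where "j \<in> {i..i + q}" "coeff f j \<noteq> 0"
        using gap[of i] 3 unfolding f_def d_def by (meson less_imp_le order_trans)
      with i 3 show ?thesis
        by (intro exI[of _ j]) auto
    qed
  qed
  then obtain m where m: "coeff f m \<noteq> 0" "m \<le> d + N" "m < card A" "d + N - m < card B"
    by blast
  show ?thesis
    using m(1,2) by (intro restricted_sumset_card_gt[OF fin _ _ m(3,4)]) (simp_all add: f_def d_def)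
qed

lemma Max_power_le:
  fixes c d :: nat
  assumes "1 < c" "1 \<le> d" and q: "q = Max {r \<in> range (\<lambda>k. c ^ k). r \<le> d}"
  obtains e where "q = c ^ e" "q \<le> d" "d < q * c"
proof -
  let ?R = "{r \<in> range (\<lambda>k. c ^ k). r \<le> d}"
  have fin: "finite ?R"
    by (rule finite_subset[of _ "{..d}"]) auto
  have "c ^ 0 \<in> ?R"
    using assms(2) by (intro CollectI conjI rangeI) simp
  then have "q \<in> ?R"
    unfolding q using fin by (intro Max_in) auto
  then obtain e where e: "q = c ^ e" "q \<le> d"
    by auto
  have "\<not> c ^ Suc e \<le> d"
  proof
    assume "c ^ Suc e \<le> d"
    then have "c ^ Suc e \<le> q"
      unfolding q using fin by (intro Max_ge) blast+
    then show False
      using assms(1) by (simp add: e)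
  qed
  then show thesis
    using e that[of e] by (simp add: mult.commute)
qed

theorem corollary2:
  fixes A B S :: "'a::field set" and p :: enat and q :: nat
  assumes "p = field_char TYPE('a)" and "p \<noteq> 2"
    and "finite A" and "A \<noteq> {}"
    and "finite B" and "B \<noteq> {}"
    and "finite S" and "S \<noteq> {}"
    and "q = Max {r \<in> char_powers p. r \<le> card S}"
  shows "ereal (real (card {a + b | a b. a \<in> A \<and> b \<in> B \<and> a - b \<notin> S}))
    \<ge> min (ereal_of_enat p)
          (ereal (real (card A) + real (card B) - real (card S) - real q - 1))"
proof -
  define C where "C = {a + b | a b. a \<in> A \<and> b \<in> B \<and> a - b \<notin> S}"
  \<comment> \<open>\<open>R\<close> is truncated at 0, which is harmless because a cardinality is never negative.\<close>
  define R where "R = card A + card B - (card S + q + 1)"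
  have R: "real (card A) + real (card B) - real (card S) - real q - 1 \<le> real R"
    unfolding R_def by linarith
  have S: "1 \<le> card S"
    using assms(7,8) by (simp add: Suc_le_eq card_gt_0_iff)
  have main: "Suc N \<le> card C"
    if "Suc N \<le> R" and "\<And>i. \<lbrakk>0 < i; i + q \<le> card S + N\<rbrakk> \<Longrightarrow>
      \<exists>j\<in>{i..i + q}. coeff ([:-1, 1:] ^ card S * [:1, 1:] ^ N) j \<noteq> (0::'a)" for N
    unfolding C_def Suc_le_eq
    using that assms(3-7) unfolding R_def
    by (intro restricted_sumset_card_gt_of_gap_bound) auto
  show ?thesis
  proof (cases "CHAR('a) = 0")
    case True
    then have "p = \<infinity>"
      by (simp add: assms(1) field_char_eq_CHAR)
    then have "{r \<in> char_powers p. r \<le> card S} = {1}"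
      using S by (auto simp: char_powers_def)
    then have q: "q = 1"
      by (simp add: assms(9))
    have "R \<le> card C"
    proof (cases R)
      case (Suc N)
      show ?thesis
        unfolding Suc
      proof (rule main)
        fix i assume "0 < i" "i + q \<le> card S + N"
        then show "\<exists>j\<in>{i..i + q}. coeff ([:-1, 1:] ^ card S * [:1, 1:] ^ N) j \<noteq> (0::'a)"
          using consecutive_coeffs_char_0[OF True, of i "card S" N] by (auto simp: q)
      qed (simp add: Suc)
    qed simp
    then show ?thesis
      unfolding C_def[symmetric] using R by (intro min.coboundedI2) simp
  next
    case False
    define c where "c = CHAR('a)"
    have p: "p = enat c"
      using False by (simp add: assms(1) field_char_eq_CHAR c_def)
    have c: "prime c"
      unfolding c_def using False by (intro prime_CHAR_semidom) simp
    moreover have "c \<noteq> 2"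
      using assms(2) by (auto simp: p numeral_eq_enat)
    ultimately have odd: "odd c"
      using prime_odd_nat prime_ge_2_nat by (metis le_neq_implies_less)
    obtain e where e: "q = c ^ e" "q \<le> card S" "card S < q * c"
      using Max_power_le[of c "card S" q] prime_gt_1_nat[OF c] S assms(9)
      by (auto simp: p char_powers_def)
    \<comment> \<open>The minimum with \<open>c\<close> ensures \<open>N < c\<close>, which the gap bound requires.\<close>
    have "min c R \<le> card C"
    proof (cases "min c R")
      case (Suc N)
      show ?thesis
        unfolding Suc
      proof (rule main)
        show "\<exists>j\<in>{i..i + q}. coeff ([:-1, 1:] ^ card S * [:1, 1:] ^ N) j \<noteq> (0::'a)"
          if "0 < i" "i + q \<le> card S + N" for i
          using that Suc by (intro consecutive_coeffs_char_p[OF c_def c odd _ e]) auto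
      qed (use Suc in linarith)
    qed simp
    then have "min (real c) (real R) \<le> real (card C)"
      by linarith
    then show ?thesis
      unfolding C_def[symmetric] p using R by (auto simp: min_def split: if_splits)
  qed
qed

end
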